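(* Let $\mathbf n=(n_k)_{k\ge1}$ and $\mathbf s=(s_k)_{k\ge1}$ be strictly increasing sequences of positive integers. If $\mathbf s$ has bounded additive gaps, then every $\mathbf s$-($\mathbf n$, strong partially greedy) Markushevich basis of a Banach space is ($\mathbf n$, strong partially greedy).
   Context: Banach spaces are separable, infinite-dimensional, over $\mathbb F=\mathbb R$ or $\mathbb C$; $\mathbb N=\{1,2,\dots\}$. A basis of $X$ is a sequence $\mathcal B=(e_n)_{n\ge1}\subset X$ whose linear span is norm-dense and for which there is a sequence $(e_n^* )_{n\ge1}\subset X^*$ with $e_j^*(e_k)=\delta_{j,k}$ and $0<\inf_n\{\|e_n\|,\|e_n^*\|\}\le\sup_n\{\|e_n\|,\|e_n^*\|\}<\infty$. It is Markushevich if moreover the span of $(e_n^* )$ is weak$^*$-dense in $X^*$. Sequences are identified with their sets of terms. For finite $A\subset\mathbb N$, $P_A(x)=\sum_{n\in A}e_n^*(x)e_n$. For $x\in X$, $m\in\mathbb N$, a greedy set of $x$ of order $m$ is a set $A\subset\mathbb N$ with $|A|=m$ and $\min_{n\in A}|e_n^*(x)|\ge\max_{n\notin A}|e_n^*(x)|$; $G_m(x)$ denotes $P_A(x)$ for such an $A$ (not necessarily unique). Put $P^{\mathbf n}_0(x)=0$, $P^{\mathbf n}_k(x)=\sum_{i=1}^k e_{n_i}^*(x)e_{n_i}$, $\widehat\sigma^{\mathbf n}_m(x)=\min_{0\le k\le m}\|x-P^{\mathbf n}_k(x)\|$. $\mathcal B$ is ($\mathbf n$, strong partially greedy) if there is $C\ge1$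 with $\|x-G_m(x)\|\le C\,\widehat\sigma^{\mathbf n}_m(x)$ for all $x\in X$, all $m\in\mathbb N$ and all choices of $G_m(x)$; it is $\mathbf s$-($\mathbf n$, strong partially greedy) if such a $C$ exists with the inequality required only for all $x\in X$, $m\in\mathbf s$ and all choices of $G_m(x)$. $\mathbf s$ has bounded additive gaps if there is $\ell\in\mathbb N$ with $\max_k(s_{k+1}-s_k)\le\ell$. *)

theory Defs
  imports "HOL-Analysis.Analysis" "HOL-Library.Function_Algebras"
begin

text \<open>
  The scalar field is a type \<open>'k\<close> of class \<open>real_normed_field\<close>. Its norm is multiplicative, so by
  the Gelfand--Mazur theorem the only such fields are, up to isometric isomorphism, the types
  \<open>real\<close> and \<open>complex\<close>. The class \<open>banach\<close> provides only a real structure on \<open>'a\<close>; the scalar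
  multiplication \<open>smul\<close> by \<open>'k\<close> extends it.
\<close>

locale banach_space_over = vector_space smul
  for smul :: "'k::real_normed_field \<Rightarrow> 'a::banach \<Rightarrow> 'a" +
  assumes smul_of_real: "smul (of_real r) x = r *\<^sub>R x"
    and norm_smul: "norm (smul c x) = norm c * norm x"
    and separable: "separable_space (euclidean :: 'a topology)"
    and infinite_dimensional: "\<nexists>B. finite B \<and> span B = UNIV"

definition dual_space :: "('k::real_normed_field \<Rightarrow> 'a::banach \<Rightarrow> 'a) \<Rightarrow> ('a \<Rightarrow> 'k) set" where
  "dual_space smul = {f. bounded_linear f \<and> (\<forall>c x. f (smul c x) = c * f x)}"

definition weak_star_topology ::
  "('k::real_normed_field \<Rightarrow> 'a::banach \<Rightarrow> 'a) \<Rightarrow> ('a \<Rightarrow> 'k) topology" where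
  "weak_star_topology smul =
     subtopology (product_topology (\<lambda>_. euclidean) UNIV) (dual_space smul)"

text \<open>
  All sequences are indexed from 1; values at index 0 are irrelevant. The coordinate functionals
  \<open>es\<close> are carried along explicitly: biorthogonality and density of the span of \<open>e\<close> determine
  \<open>es n\<close> uniquely for \<open>n \<ge> 1\<close>.
\<close>

definition basis ::
  "('k::real_normed_field \<Rightarrow> 'a::banach \<Rightarrow> 'a) \<Rightarrow> (nat \<Rightarrow> 'a) \<Rightarrow> (nat \<Rightarrow> 'a \<Rightarrow> 'k) \<Rightarrow> bool" where
  "basis smul e es \<longleftrightarrow>
     closure (module.span smul (e ` {1..})) = UNIV \<and>
     (\<forall>n\<ge>1. es n \<in> dual_space smul) \<and>
     (\<forall>j\<ge>1. \<forall>k\<ge>1. es j (e k) = (if j = k then 1 else 0)) \<and>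
     0 < Inf ((\<lambda>n. norm (e n)) ` {1..} \<union> (\<lambda>n. onorm (es n)) ` {1..}) \<and>
     bdd_above ((\<lambda>n. norm (e n)) ` {1..} \<union> (\<lambda>n. onorm (es n)) ` {1..})"

definition markushevich_basis ::
  "('k::real_normed_field \<Rightarrow> 'a::banach \<Rightarrow> 'a) \<Rightarrow> (nat \<Rightarrow> 'a) \<Rightarrow> (nat \<Rightarrow> 'a \<Rightarrow> 'k) \<Rightarrow> bool" where
  "markushevich_basis smul e es \<longleftrightarrow>
     basis smul e es \<and>
     weak_star_topology smul closure_of (module.span (\<lambda>c f x. c * f x) (es ` {1..}))
       = dual_space smul"

definition proj ::
  "('k \<Rightarrow> 'a \<Rightarrow> 'a) \<Rightarrow> (nat \<Rightarrow> 'a) \<Rightarrow> (nat \<Rightarrow> 'a \<Rightarrow> 'k) \<Rightarrow> nat set \<Rightarrow> 'a \<Rightarrow> 'a::banach" where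
  "proj smul e es A x = (\<Sum>n\<in>A. smul (es n x) (e n))"

definition greedy_set ::
  "(nat \<Rightarrow> 'a \<Rightarrow> 'k::real_normed_field) \<Rightarrow> 'a \<Rightarrow> nat \<Rightarrow> nat set \<Rightarrow> bool" where
  "greedy_set es x m A \<longleftrightarrow>
     A \<subseteq> {1..} \<and> finite A \<and> card A = m \<and>
     (\<forall>i\<in>A. \<forall>j\<in>{1..} - A. norm (es i x) \<ge> norm (es j x))"

definition partial_sum_along ::
  "('k \<Rightarrow> 'a \<Rightarrow> 'a) \<Rightarrow> (nat \<Rightarrow> 'a) \<Rightarrow> (nat \<Rightarrow> 'a \<Rightarrow> 'k) \<Rightarrow> (nat \<Rightarrow> nat) \<Rightarrow> nat \<Rightarrow> 'a \<Rightarrow> 'a::banach"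
  where
  "partial_sum_along smul e es n k x = (\<Sum>i = 1..k. smul (es (n i) x) (e (n i)))"

definition sigma_hat ::
  "('k \<Rightarrow> 'a \<Rightarrow> 'a) \<Rightarrow> (nat \<Rightarrow> 'a) \<Rightarrow> (nat \<Rightarrow> 'a \<Rightarrow> 'k) \<Rightarrow> (nat \<Rightarrow> nat) \<Rightarrow> nat \<Rightarrow> 'a::banach \<Rightarrow> real"
  where
  "sigma_hat smul e es n m x = (MIN k\<in>{0..m}. norm (x - partial_sum_along smul e es n k x))"

definition strong_partially_greedy ::
  "('k::real_normed_field \<Rightarrow> 'a::banach \<Rightarrow> 'a) \<Rightarrow> (nat \<Rightarrow> 'a) \<Rightarrow> (nat \<Rightarrow> 'a \<Rightarrow> 'k) \<Rightarrow>
     (nat \<Rightarrow> nat) \<Rightarrow> bool" where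
  "strong_partially_greedy smul e es n \<longleftrightarrow>
     (\<exists>C\<ge>1. \<forall>x. \<forall>m\<ge>1. \<forall>A. greedy_set es x m A \<longrightarrow>
        norm (x - proj smul e es A x) \<le> C * sigma_hat smul e es n m x)"

definition strong_partially_greedy_for ::
  "(nat \<Rightarrow> nat) \<Rightarrow> ('k::real_normed_field \<Rightarrow> 'a::banach \<Rightarrow> 'a) \<Rightarrow> (nat \<Rightarrow> 'a) \<Rightarrow>
     (nat \<Rightarrow> 'a \<Rightarrow> 'k) \<Rightarrow> (nat \<Rightarrow> nat) \<Rightarrow> bool" where
  "strong_partially_greedy_for s smul e es n \<longleftrightarrow>
     (\<exists>C\<ge>1. \<forall>x. \<forall>m\<in>s ` {1..}. \<forall>A. greedy_set es x m A \<longrightarrow>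
        norm (x - proj smul e es A x) \<le> C * sigma_hat smul e es n m x)"

definition increasing_pos_seq :: "(nat \<Rightarrow> nat) \<Rightarrow> bool" where
  "increasing_pos_seq s \<longleftrightarrow> s ` {1..} \<subseteq> {1..} \<and> strict_mono_on {1..} s"

definition bounded_additive_gaps :: "(nat \<Rightarrow> nat) \<Rightarrow> bool" where
  "bounded_additive_gaps s \<longleftrightarrow> (\<exists>l\<ge>1. \<forall>k\<ge>1. s (k + 1) - s k \<le> l)"

end

theory Submission
  imports Defs
begin

text \<open>
  Let \<open>A\<close> be a greedy set of \<open>x\<close> of order \<open>m\<close>, and let \<open>S\<close> be the partial sum of \<open>x\<close> along \<open>n\<close>, with
  \<open>k \<le> m\<close> terms, that attains the minimum \<open>sigma_hat\<close>. The hypothesis speaks only of orders in \<open>s\<close>,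
  and the idea is to move from \<open>m\<close> up to the next order \<open>t \<ge> m\<close> in \<open>s\<close>, not down. Going up is
  harmless for \<open>S\<close>, which is still among the competitors at order \<open>t\<close>; going down could discard it,
  and terms of \<open>S\<close> cannot be estimated by \<open>norm (x - S)\<close>.

  So enlarge \<open>A\<close> to a greedy set \<open>B\<close> of order \<open>t\<close> (\<open>greedy_set_enlarge\<close>), which is possible because
  the coefficients of \<open>x\<close> tend to zero (\<open>finite_large_coefficients\<close>). The hypothesis controls
  \<open>x - proj B x\<close>, and there remains \<open>proj (B - A) x\<close>. By bounded gaps it has a bounded number of
  terms, so it is enough to bound each coefficient of \<open>x\<close> outside \<open>A\<close> by a multiple of
  \<open>norm (x - S)\<close>. If some \<open>a \<in> A\<close> is not an index of \<open>S\<close>, then the coefficient at \<open>a\<close> is that of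
  \<open>x - S\<close>, hence is at most a multiple of \<open>norm (x - S)\<close>, and it dominates all coefficients outside
  \<open>A\<close> (\<open>coefficient_outside_greedy_set\<close>). Otherwise \<open>A\<close> consists of indices of \<open>S\<close>, and as \<open>S\<close> has
  at most \<open>m\<close> of them, \<open>proj A x = S\<close> and the estimate is trivial.
\<close>

section \<open>Coefficients with respect to a bounded biorthogonal system\<close>

text \<open>
  One constant \<open>K\<close> bounds both the vectors and the functionals: every estimate below turns a
  distance into a coefficient at the cost of one factor \<open>K\<close>, and a coefficient back into a term at
  the cost of another.
\<close>

locale bounded_biorthogonal_system = vector_space smul
  for smul :: "'k::real_normed_field \<Rightarrow> 'a::banach \<Rightarrow> 'a" +
  fixes e :: "nat \<Rightarrow> 'a" and es :: "nat \<Rightarrow> 'a \<Rightarrow> 'k" and K :: real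
  assumes norm_smul: "norm (smul c x) = norm c * norm x"
    and dense: "closure (span (e ` {1..})) = UNIV"
    and es_linear: "i \<ge> 1 \<Longrightarrow> bounded_linear (es i)"
    and es_smul: "i \<ge> 1 \<Longrightarrow> es i (smul c x) = c * es i x"
    and biorthogonal: "i \<ge> 1 \<Longrightarrow> j \<ge> 1 \<Longrightarrow> es i (e j) = (if i = j then 1 else 0)"
    and norm_e: "i \<ge> 1 \<Longrightarrow> norm (e i) \<le> K"
    and norm_es: "i \<ge> 1 \<Longrightarrow> norm (es i x) \<le> K * norm x"
begin

abbreviation P :: "nat set \<Rightarrow> 'a \<Rightarrow> 'a" where
  "P \<equiv> proj smul e es"

lemma K_nonneg: "0 \<le> K"
  using norm_e[of 1] norm_ge_zero[of "e 1"] by linarith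

lemma finite_support_on_span:
  assumes "y \<in> span (e ` {1..})"
  shows "finite {i. i \<ge> 1 \<and> es i y \<noteq> 0}"
  using assms
proof (induction rule: span_induct_alt)
  case base
  have "es i 0 = 0" if "i \<ge> 1" for i
    using es_linear[OF that] by (simp add: linear_simps)
  then have "{i. i \<ge> 1 \<and> es i 0 \<noteq> 0} = {}"
    by auto
  then show ?case
    by (simp only: finite.emptyI)
next
  case (step c v y)
  then obtain j where j: "j \<ge> 1" "v = e j"
    by auto
  have "es i (smul c v + y) = c * es i (e j) + es i y" if "i \<ge> 1" for i
    using es_linear[OF that] es_smul[OF that] j by (simp add: linear_simps)
  then have "{i. i \<ge> 1 \<and> es i (smul c v + y) \<noteq> 0} \<subseteq> insert j {i. i \<ge> 1 \<and> es i y \<noteq> 0}"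
    using biorthogonal j by auto
  then show ?case
    using step finite_subset by blast
qed

text \<open>
  Coefficients tend to zero: this is clear on the span, and the uniform bound on the functionals
  carries it over to the closure.
\<close>

lemma finite_large_coefficients:
  assumes "\<epsilon> > 0"
  shows "finite {i. i \<ge> 1 \<and> norm (es i x) \<ge> \<epsilon>}"
proof -
  define \<delta> where "\<delta> = \<epsilon> / (K + 1)"
  have "\<delta> > 0"
    using assms K_nonneg by (simp add: \<delta>_def)
  moreover have "x \<in> closure (span (e ` {1..}))"
    using dense by simp
  ultimately obtain y where y: "y \<in> span (e ` {1..})" "norm (x - y) < \<delta>"
    unfolding closure_approachable by (metis dist_commute dist_norm)
  have "es i y \<noteq> 0" if "i \<ge> 1" "norm (es i x) \<ge> \<epsilon>" for i
  proof
    assume "es i y = 0"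
    then have "es i x = es i (x - y)"
      using es_linear[OF that(1)] by (simp add: linear_simps)
    then have "norm (es i x) \<le> K * norm (x - y)"
      using norm_es[OF that(1), of "x - y"] by simp
    also have "\<dots> \<le> K * \<delta>"
      using y K_nonneg by (intro mult_left_mono) auto
    also have "\<dots> < \<epsilon>"
      using assms K_nonneg by (simp add: \<delta>_def field_simps)
    finally show False
      using that by simp
  qed
  then have "{i. i \<ge> 1 \<and> norm (es i x) \<ge> \<epsilon>} \<subseteq> {i. i \<ge> 1 \<and> es i y \<noteq> 0}"
    by blast
  then show ?thesis
    using finite_support_on_span[OF y(1)] finite_subset by blast
qed

section \<open>Passing to a larger greedy set\<close>

lemma greedy_set_enlarge_by_one:
  assumes A: "greedy_set es x m A"
  shows "\<exists>B. greedy_set es x (Suc m) B \<and> A \<subseteq> B"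
proof -
  have fin: "finite A"
    using A by (simp add: greedy_set_def)
  \<comment> \<open>A largest coefficient outside \<open>A\<close> exists, although infinitely many indices compete.\<close>
  obtain p where p: "p \<in> {1..} - A" "\<And>j. j \<in> {1..} - A \<Longrightarrow> norm (es j x) \<le> norm (es p x)"
  proof (cases "\<exists>q\<in>{1..} - A. es q x \<noteq> 0")
    case True
    then obtain q where q: "q \<in> {1..} - A" "es q x \<noteq> 0"
      by blast
    define F where "F = {i. i \<ge> 1 \<and> norm (es i x) \<ge> norm (es q x)} - A"
    have "finite F" "q \<in> F"
      using q finite_large_coefficients[of "norm (es q x)" x] by (auto simp: F_def)
    then have "Max ((\<lambda>i. norm (es i x)) ` F) \<in> (\<lambda>i. norm (es i x)) ` F"
      by (intro Max_in) auto
    then obtain p where p: "p \<in> F" "Max ((\<lambda>i. norm (es i x)) ` F) = norm (es p x)"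
      by blast
    have max: "norm (es j x) \<le> norm (es p x)" if "j \<in> F" for j
      unfolding p(2)[symmetric] using that \<open>finite F\<close> by simp
    have "norm (es j x) \<le> norm (es p x)" if "j \<in> {1..} - A" for j
      using that p(1) max by (cases "j \<in> F") (auto simp: F_def)
    then show ?thesis
      using that p(1) by (auto simp: F_def)
  next
    case False
    have "infinite ({1::nat..} - A)"
      using fin by (simp add: infinite_Ici)
    then have "{1..} - A \<noteq> {}"
      by (metis finite.emptyI)
    then obtain p where "p \<in> {1..} - A"
      by blast
    then show ?thesis
      using that[of p] False by simp
  qed
  have "greedy_set es x (Suc m) (insert p A)"
    using A p unfolding greedy_set_def by auto
  then show ?thesis
    by blast
qed

lemma greedy_set_enlarge:
  assumes "greedy_set es x m A" "m \<le> t"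
  shows "\<exists>B. greedy_set es x t B \<and> A \<subseteq> B"
  using assms(2)
proof (induction t rule: dec_induct)
  case base
  then show ?case
    using assms(1) by blast
next
  case (step t)
  then show ?case
    using greedy_set_enlarge_by_one by (metis subset_trans)
qed

lemma coefficient_outside_proj:
  assumes D: "finite D" "D \<subseteq> {1..}" and i: "i \<ge> 1" "i \<notin> D"
  shows "es i (x - P D x) = es i x"
proof -
  interpret bounded_linear "es i"
    using es_linear[OF i(1)] .
  have "es i (P D x) = (\<Sum>j\<in>D. es j x * es i (e j))"
    unfolding proj_def by (simp add: sum es_smul[OF i(1)])
  also have "\<dots> = 0"
    using D i by (intro sum.neutral) (auto simp: biorthogonal subset_iff)
  finally show ?thesis
    by (simp add: diff)
qed

lemma coefficient_outside_greedy_set: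
  assumes A: "greedy_set es x m A" and D: "finite D" "D \<subseteq> {1..}"
    and a: "a \<in> A" "a \<notin> D" and i: "i \<in> {1..} - A"
  shows "norm (es i x) \<le> K * norm (x - P D x)"
proof -
  have a1: "a \<ge> 1"
    using A a by (auto simp: greedy_set_def)
  have "norm (es i x) \<le> norm (es a x)"
    using A a i by (auto simp: greedy_set_def)
  also have "\<dots> = norm (es a (x - P D x))"
    using coefficient_outside_proj[OF D a1 a(2)] by simp
  also have "\<dots> \<le> K * norm (x - P D x)"
    by (rule norm_es[OF a1])
  finally show ?thesis .
qed

lemma norm_proj_le:
  assumes "F \<subseteq> {1..}" "\<And>i. i \<in> F \<Longrightarrow> norm (es i x) \<le> M"
  shows "norm (P F x) \<le> real (card F) * (M * K)"
  unfolding proj_def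
proof (rule sum_norm_bound)
  fix i assume i: "i \<in> F"
  then have "0 \<le> M"
    using assms(2) norm_ge_zero order_trans by blast
  then show "norm (smul (es i x) (e i)) \<le> M * K"
    unfolding norm_smul using assms i by (intro mult_mono norm_e) auto
qed

text \<open>
  Either \<open>A\<close> lies in \<open>D\<close>, and then equals it by cardinality, or \<open>A\<close> has an index outside \<open>D\<close>, and
  then each of the \<open>t - m\<close> indices that enlarge \<open>A\<close> to order \<open>t\<close> contributes a term of norm at most
  \<open>K\<^sup>2 * norm (x - P D x)\<close>. The set \<open>D\<close> stands for the indices of a partial sum along a sequence,
  but the argument works for any projection onto at most \<open>m\<close> coordinates.
\<close>

lemma greedy_error_le_at_larger_order:
  assumes A: "greedy_set es x m A" and t: "m \<le> t"
    and D: "finite D" "D \<subseteq> {1..}" "card D \<le> m"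
    and C: "C \<ge> 1"
    and at_t: "\<And>B. greedy_set es x t B \<Longrightarrow> norm (x - P B x) \<le> C * norm (x - P D x)"
  shows "norm (x - P A x) \<le> (C + real (t - m) * K\<^sup>2) * norm (x - P D x)"
proof (cases "A \<subseteq> D")
  case True
  then have "A = D"
    using A D card_seteq by (fastforce simp: greedy_set_def)
  moreover have "1 \<le> C + real (t - m) * K\<^sup>2"
    using C by (simp add: add_increasing2)
  ultimately show ?thesis
    using mult_right_mono[of 1 "C + real (t - m) * K\<^sup>2" "norm (x - P D x)"]
    by (metis mult_1 norm_ge_zero)
next
  case False
  then obtain a where a: "a \<in> A" "a \<notin> D"
    by blast
  obtain B where B: "greedy_set es x t B" "A \<subseteq> B"
    using greedy_set_enlarge[OF A t] by blast
  have fin: "finite A" "finite B" "card A = m" "card B = t" "B \<subseteq> {1..}"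
    using A B by (auto simp: greedy_set_def)
  have "card (B - A) = t - m"
    using B fin by (simp add: card_Diff_subset)
  moreover have "norm (es i x) \<le> K * norm (x - P D x)" if "i \<in> B - A" for i
    using coefficient_outside_greedy_set[OF A D(1,2) a] that fin by blast
  ultimately have rest: "norm (P (B - A) x) \<le> real (t - m) * (K * norm (x - P D x) * K)"
    using norm_proj_le[of "B - A" x "K * norm (x - P D x)"] fin by (metis Diff_subset subset_trans)
  have "P B x = P (B - A) x + P A x"
    unfolding proj_def using B(2) fin by (simp add: sum.subset_diff)
  then have "x - P A x = (x - P B x) + P (B - A) x"
    by simp
  then have "norm (x - P A x) \<le> norm (x - P B x) + norm (P (B - A) x)"
    using norm_triangle_ineq by metis
  also have "\<dots> \<le> C * norm (x - P D x) + real (t - m) * (K * norm (x - P D x) * K)"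
    using at_t[OF B(1)] rest by linarith
  finally show ?thesis
    by (simp add: algebra_simps power2_eq_square)
qed

lemma partial_sum_along_eq_proj:
  assumes "increasing_pos_seq n"
  shows "partial_sum_along smul e es n k x = P (n ` {1..k}) x"
proof -
  have "inj_on n {1..k}"
    using assms strict_mono_on_imp_inj_on inj_on_subset[of n "{1..}" "{1..k}"]
    by (auto simp: increasing_pos_seq_def)
  then show ?thesis
    by (simp add: partial_sum_along_def proj_def sum.reindex)
qed

end

lemma basis_imp_bounded_biorthogonal_system:
  assumes X: "banach_space_over smul" and b: "basis smul e es"
  shows "\<exists>K. bounded_biorthogonal_system smul e es K"
proof -
  interpret banach_space_over smul
    by (rule X)
  obtain K where K: "\<forall>r \<in> (\<lambda>n. norm (e n)) ` {1..} \<union> (\<lambda>n. onorm (es n)) ` {1..}. r \<le> K"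
    using b unfolding basis_def bdd_above_def by blast
  have lin: "bounded_linear (es i)" if "i \<ge> 1" for i
    using b that by (simp add: basis_def dual_space_def)
  have "norm (es i x) \<le> K * norm x" if "i \<ge> 1" for i x
  proof -
    have "norm (es i x) \<le> onorm (es i) * norm x"
      by (rule onorm[OF lin[OF that]])
    also have "\<dots> \<le> K * norm x"
      using K that by (intro mult_right_mono) auto
    finally show ?thesis .
  qed
  then have "bounded_biorthogonal_system smul e es K"
    using b K lin norm_smul
    by (intro bounded_biorthogonal_system.intro bounded_biorthogonal_system_axioms.intro
        vector_space_axioms) (simp_all add: basis_def dual_space_def)
  then show ?thesis ..
qed

section \<open>Partial sums along a sequence and bounded gaps\<close>

lemma sigma_hat_le:
  assumes "k \<le> m"
  shows "sigma_hat smul e es n m x \<le> norm (x - partial_sum_along smul e es n k x)"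
  unfolding sigma_hat_def using assms by (intro Min_le) auto

lemma sigma_hat_attained:
  obtains k where "k \<le> m"
    "sigma_hat smul e es n m x = norm (x - partial_sum_along smul e es n k x)"
proof -
  have "sigma_hat smul e es n m x
      \<in> (\<lambda>k. norm (x - partial_sum_along smul e es n k x)) ` {0..m}"
    unfolding sigma_hat_def by (intro Min_in) auto
  then show thesis
    using that by auto
qed

text \<open>
  The summand \<open>s 1\<close> accounts for the orders \<open>m\<close> that precede the whole sequence.
\<close>

lemma next_term_of_bounded_gaps:
  assumes s: "increasing_pos_seq s" and gap: "\<And>k. k \<ge> 1 \<Longrightarrow> s (k + 1) - s k \<le> l"
  shows "\<exists>t \<in> s ` {1..}. m \<le> t \<and> t - m \<le> s 1 + l"
proof (induction m)
  case 0
  then show ?case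
    by (intro bexI[of _ "s 1"]) auto
next
  case (Suc m)
  then obtain k where k: "k \<ge> 1" "m \<le> s k" "s k - m \<le> s 1 + l"
    by auto
  show ?case
  proof (cases "m = s k")
    case True
    have "s k < s (k + 1)"
      using s k by (auto simp: increasing_pos_seq_def strict_mono_on_def)
    then show ?thesis
      using gap[OF k(1)] True by (intro bexI[of _ "s (k + 1)"]) auto
  next
    case False
    then show ?thesis
      using k by (intro bexI[of _ "s k"]) auto
  qed
qed

theorem proposition7p22:
  fixes smul :: "'k::real_normed_field \<Rightarrow> 'a::banach \<Rightarrow> 'a"
    and e :: "nat \<Rightarrow> 'a" and es :: "nat \<Rightarrow> 'a \<Rightarrow> 'k"
    and n s :: "nat \<Rightarrow> nat"
  assumes "increasing_pos_seq n" and "increasing_pos_seq s"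
    and "bounded_additive_gaps s"
    and "banach_space_over smul"
    and "markushevich_basis smul e es"
    and "strong_partially_greedy_for s smul e es n"
  shows "strong_partially_greedy smul e es n"
proof -
  obtain K where "bounded_biorthogonal_system smul e es K"
    using assms(4,5) basis_imp_bounded_biorthogonal_system
    unfolding markushevich_basis_def by blast
  then interpret bounded_biorthogonal_system smul e es K .
  obtain l where l: "\<And>k. k \<ge> 1 \<Longrightarrow> s (k + 1) - s k \<le> l"
    using assms(3) unfolding bounded_additive_gaps_def by blast
  obtain C where C: "C \<ge> 1"
    "\<And>x m A. m \<in> s ` {1..} \<Longrightarrow> greedy_set es x m A \<Longrightarrow>
      norm (x - P A x) \<le> C * sigma_hat smul e es n m x"
    using assms(6) unfolding strong_partially_greedy_for_def by blast
  define C' where "C' = C + real (s 1 + l) * K\<^sup>2"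
  have "norm (x - P A x) \<le> C' * sigma_hat smul e es n m x" if A: "greedy_set es x m A" for x m A
  proof -
    obtain k where k: "k \<le> m"
      "sigma_hat smul e es n m x = norm (x - partial_sum_along smul e es n k x)"
      by (rule sigma_hat_attained)
    define D where "D = n ` {1..k}"
    have S: "partial_sum_along smul e es n k x = P D x"
      unfolding D_def by (rule partial_sum_along_eq_proj[OF assms(1)])
    have D: "finite D" "D \<subseteq> {1..}" "card D \<le> m"
      using assms(1) k(1) card_image_le[of "{1..k}" n]
      by (auto simp: D_def increasing_pos_seq_def image_subset_iff)
    obtain t where t: "t \<in> s ` {1..}" "m \<le> t" "t - m \<le> s 1 + l"
      using next_term_of_bounded_gaps[OF assms(2) l, of m] by auto
    have "norm (x - P B x) \<le> C * norm (x - P D x)" if "greedy_set es x t B" for B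
    proof -
      have "sigma_hat smul e es n t x \<le> norm (x - P D x)"
        using sigma_hat_le[of k t] k(1) t(2) S by (metis order_trans)
      then have "C * sigma_hat smul e es n t x \<le> C * norm (x - P D x)"
        using C(1) by (intro mult_left_mono) auto
      with C(2)[OF t(1) that] show ?thesis
        by (rule order_trans)
    qed
    then have "norm (x - P A x) \<le> (C + real (t - m) * K\<^sup>2) * norm (x - P D x)"
      using greedy_error_le_at_larger_order[OF A t(2) D C(1)] by simp
    also have "\<dots> \<le> C' * norm (x - P D x)"
      unfolding C'_def using t(3)
      by (intro mult_right_mono add_left_mono of_nat_mono) auto
    finally show ?thesis
      by (simp add: k(2) S)
  qed
  moreover have "C' \<ge> 1"
    using C(1) by (simp add: C'_def add_increasing2)
  ultimately show ?thesis
    unfolding strong_partially_greedy_def by blast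
qed

end
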